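(* Let $\lambda\in(0,\infty)$ and suppose that either (i) $\lambda$ is an algebraic number of algebraic degree $2$, or (ii) $\lambda\leq 2$. Then $\kappa(\lambda)<\infty$ if and only if $\lambda$ satisfies both of the following: (1) $\lambda$ is a totally real algebraic integer; (2) $\lambda\geq|\mu|$ for every algebraic conjugate $\mu$ of $\lambda$.
   Context: All graphs are finite simple graphs (no loops, no multiple edges). The spectral radius $\lambda_1(G)$ of a graph $G$ is the largest eigenvalue of its adjacency matrix. For $\lambda\geq 0$, the spectral radius order $\kappa(\lambda)$ is the minimum number of vertices of a graph $G$ with $\lambda_1(G)=\lambda$; if no graph has spectral radius $\lambda$, then $\kappa(\lambda)=+\infty$. An algebraic conjugate of an algebraic integer $\gamma$ is a root of its minimal polynomial; $\gamma$ is totally real if all its algebraic conjugates are real. *)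

theory Defs
  imports
    "HOL-Library.Extended_Nat"
    "Graph_Theory.Pair_Digraph"
    "Jordan_Normal_Form.Spectral_Radius"
begin

text \<open>
  A finite simple graph is a \<^locale>\<open>pair_graph\<close>: a finite vertex set with a symmetric,
  irreflexive set of ordered pairs of vertices, each edge being represented by both of its
  orientations.
\<close>

text \<open>Rows and columns are indexed by the vertices in increasing order.\<close>

definition adjacency_matrix :: "'a::linorder pair_pre_digraph \<Rightarrow> real mat" where
  "adjacency_matrix G =
     (let vs = sorted_list_of_set (pverts G); n = card (pverts G)
      in mat n n (\<lambda>(i, j). if (vs ! i, vs ! j) \<in> parcs G then 1 else 0))"

text \<open>
  The largest (signed) real eigenvalue. It is only meaningful for graphs with at least one vertex,
  as the \<^const>\<open>spectrum\<close> of the empty matrix is empty.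
\<close>

definition graph_spectral_radius :: "'a::linorder pair_pre_digraph \<Rightarrow> real" where
  "graph_spectral_radius G = Max (spectrum (adjacency_matrix G))"

text \<open>
  Every finite graph is isomorphic to one with vertices in \<^typ>\<open>nat\<close>. The infimum of a
  nonempty set in \<^typ>\<open>enat\<close> is attained, and that of the empty set is \<open>\<infinity>\<close>.
\<close>

definition spectral_radius_order :: "real \<Rightarrow> enat" where
  "spectral_radius_order x =
     Inf {enat (card (pverts G)) | G :: nat pair_pre_digraph.
            pair_graph G \<and> pverts G \<noteq> {} \<and> graph_spectral_radius G = x}"

definition is_min_poly :: "rat poly \<Rightarrow> 'a::field_char_0 \<Rightarrow> bool" where
  "is_min_poly p x \<longleftrightarrow>
     lead_coeff p = 1 \<and> poly (map_poly of_rat p) x = 0 \<and>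
     (\<forall>q. q \<noteq> 0 \<and> poly (map_poly of_rat q) x = 0 \<longrightarrow> degree p \<le> degree q)"

text \<open>
  The following notions are only meaningful for algebraic \<open>x\<close>; see \<open>is_min_poly_min_poly\<close>.
\<close>

definition min_poly :: "'a::field_char_0 \<Rightarrow> rat poly" where
  "min_poly x = (THE p. is_min_poly p x)"

definition algebraic_degree :: "'a::field_char_0 \<Rightarrow> nat" where
  "algebraic_degree x = degree (min_poly x)"

definition algebraic_conjugates :: "'a::field_char_0 \<Rightarrow> complex set" where
  "algebraic_conjugates x = {y. poly (map_poly of_rat (min_poly x)) y = 0}"

definition totally_real_algebraic_int :: "'a::field_char_0 \<Rightarrow> bool" where
  "totally_real_algebraic_int x \<longleftrightarrow> algebraic_int x \<and> algebraic_conjugates x \<subseteq> \<real>"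

lemma is_min_poly_unique:
  fixes x :: "'a::field_char_0"
  assumes p: "is_min_poly p x" and q: "is_min_poly q x"
  shows "p = q"
proof (rule ccontr)
  assume "p \<noteq> q"
  then have ne: "p - q \<noteq> 0" by simp
  have p0: "p \<noteq> 0" and q0: "q \<noteq> 0" using p q by (auto simp: is_min_poly_def)
  have deg: "degree p = degree q"
    using p q p0 q0 by (intro antisym) (auto simp: is_min_poly_def)
  have "map_poly of_rat (p - q) = map_poly of_rat p - (map_poly of_rat q :: 'a poly)"
    by (intro poly_eqI) (simp add: coeff_map_poly of_rat_diff)
  then have root: "poly (map_poly of_rat (p - q)) x = 0"
    using p q by (simp add: is_min_poly_def)
  have le: "degree p \<le> degree (p - q)"
    using p ne root by (auto simp: is_min_poly_def)
  have "degree (p - q) \<le> degree p"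
    using deg by (intro degree_diff_le) auto
  then have "degree (p - q) = degree p" using le by simp
  moreover have "coeff (p - q) (degree p) = 0"
    using p q deg by (simp add: is_min_poly_def)
  ultimately show False using ne by (metis leading_coeff_0_iff)
qed

lemma is_min_poly_exists:
  fixes x :: "'a::field_char_0"
  assumes "algebraic x"
  shows "\<exists>p. is_min_poly p x"
proof -
  let ?R = "\<lambda>q :: rat poly. q \<noteq> 0 \<and> poly (map_poly of_rat q) x = 0"
  obtain r :: "'a poly" where r: "\<And>i. coeff r i \<in> \<int>" "r \<noteq> 0" "poly r x = 0"
    using assms by (auto simp: algebraic_def)
  have "\<exists>f :: nat \<Rightarrow> int. \<forall>i. coeff r i = of_int (f i)"
    using r(1) by (intro choice) (auto elim: Ints_cases)
  then obtain f :: "nat \<Rightarrow> int" where f: "\<And>i. coeff r i = of_int (f i)" by blast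
  define q :: "rat poly" where "q = Poly (map (\<lambda>i. of_int (f i)) [0..<Suc (degree r)])"
  have "coeff (map_poly of_rat q) i = coeff r i" for i
    by (cases "i \<le> degree r")
       (auto simp: q_def coeff_map_poly nth_default_def f[symmetric] coeff_eq_0 simp del: upt_Suc)
  then have qr: "map_poly of_rat q = r" by (simp add: poly_eq_iff)
  then have "?R q" using r(2,3) by auto
  then obtain m where m: "?R m" and min: "\<And>s. ?R s \<Longrightarrow> degree m \<le> degree s"
    using ex_has_least_nat[of ?R q degree] by auto
  define p where "p = Polynomial.smult (inverse (lead_coeff m)) m"
  have "map_poly of_rat p =
      Polynomial.smult (of_rat (inverse (lead_coeff m))) (map_poly of_rat m :: 'a poly)"
    by (intro poly_eqI) (simp add: p_def coeff_map_poly of_rat_mult)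
  then have "is_min_poly p x"
    using m min by (auto simp: is_min_poly_def p_def)
  then show ?thesis by blast
qed

lemma is_min_poly_min_poly:
  fixes x :: "'a::field_char_0"
  assumes "algebraic x"
  shows "is_min_poly (min_poly x) x"
  unfolding min_poly_def
  using is_min_poly_exists[OF assms] is_min_poly_unique by (metis theI)

end

theory Submission
  imports
    Defs
    "HOL-Computational_Algebra.Polynomial_Factorial"
    "HOL-Number_Theory.Cong"
    "HOL-Analysis.Function_Topology"
begin

text \<open>
  If \<open>x\<close> is the spectral radius of a graph, its conjugates are roots of the integral characteristic
  polynomial of the symmetric adjacency matrix, hence real eigenvalues, and they are bounded by the
  maximum of the Rayleigh quotient, which is itself an eigenvalue.

  For the converse it suffices to find a graph having a positive eigenvector for \<open>x\<close>.
  A quadratic \<open>x\<close> satisfies \<open>(x - k) (x - l) = c\<close> with \<open>k\<close> and \<open>l\<close> the two halves of its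
  trace and \<open>c \<ge> 1\<close>; this is the characteristic equation of the quotient matrix of an equitable
  partition into a \<open>k\<close>-regular and an \<open>l\<close>-regular part.
  If \<open>x \<le> 2\<close>, all conjugates lie in \<open>[-2, 2]\<close>, so Kronecker's argument gives
  \<open>x = z + 1 / z\<close> with \<open>z\<close> a root of unity of some order \<open>n\<close>. As all \<open>z ^ j\<close> with \<open>j\<close> prime to \<open>n\<close>
  are conjugate, maximality of \<open>x\<close> among its conjugates forces \<open>x = 2\<close> (a triangle) or
  \<open>x = 2 cos (pi / m)\<close> (a path on \<open>m - 1\<close> vertices).
\<close>

section \<open>Integral minimal polynomials\<close>

abbreviation ipoly :: "int poly \<Rightarrow> 'a::comm_ring_1 \<Rightarrow> 'a" where
  "ipoly f x \<equiv> poly (map_poly of_int f) x"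

lemma ipoly_simps [simp]:
  "ipoly (f + g) x = ipoly f x + ipoly g x"
  "ipoly (f - g) x = ipoly f x - ipoly g x"
  "ipoly (- f) x = - ipoly f x"
  "ipoly (f * g) x = ipoly f x * ipoly g x"
  "ipoly (f ^ n) x = ipoly f x ^ n"
  "ipoly (Polynomial.smult c f) x = of_int c * ipoly f x"
  "ipoly 1 x = 1" "ipoly [:c:] x = of_int c"
  by (simp_all add: hom_distribs)

lemma ipoly_of_real: "ipoly f (of_real x) = of_real (ipoly f x)"
  by (induction f) (simp_all add: hom_distribs)

text \<open>Minimality is divisibility inside \<open>int poly\<close>, so that the arguments can
  stay over the integers. Such a polynomial exists exactly for algebraic integers.\<close>

definition int_min_poly :: "int poly \<Rightarrow> 'a::field_char_0 \<Rightarrow> bool" where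
  "int_min_poly f x \<longleftrightarrow> lead_coeff f = 1 \<and> ipoly f x = 0 \<and> (\<forall>g. ipoly g x = 0 \<longrightarrow> f dvd g)"

lemma monic_int_division:
  fixes f g :: "int poly"
  assumes "lead_coeff f = 1"
  obtains q r where "g = f * q + r" "r = 0 \<or> degree r < degree f"
proof -
  obtain q r where qr: "pseudo_divmod g f = (q, r)" by (cases "pseudo_divmod g f")
  have "f \<noteq> 0" using assms by auto
  with pseudo_divmod[OF this qr] assms show ?thesis by (intro that[of q r]) auto
qed

text \<open>Gauss's lemma: the primitive part \<open>q\<close> of an annihilator of least degree
  divides every annihilator over the integers; as it divides a monic one, its leading coefficient is
  1 or -1.\<close>

lemma int_min_poly_exists:
  fixes x :: "'a::field_char_0"
  assumes "algebraic_int x"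
  obtains f where "int_min_poly f x"
proof -
  obtain P where P: "ipoly P x = 0" "lead_coeff P = 1"
    using assms by (auto simp: algebraic_int_altdef_ipoly)
  let ?R = "\<lambda>q :: int poly. q \<noteq> 0 \<and> ipoly q x = 0"
  have "?R P" using P by auto
  then obtain m where m: "?R m" and min: "\<And>s. ?R s \<Longrightarrow> degree m \<le> degree s"
    using ex_has_least_nat[of ?R P degree] by auto
  define q where "q = primitive_part m"
  have mq: "m = Polynomial.smult (content m) q" by (simp add: q_def)
  have q: "q \<noteq> 0" "content q = 1" "degree q = degree m" "ipoly q x = 0"
  proof -
    show "q \<noteq> 0" "content q = 1" "degree q = degree m" using m by (simp_all add: q_def)
    have "of_int (content m) * ipoly q x = 0" using m mq by (metis ipoly_simps(6))
    then show "ipoly q x = 0" using m by auto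
  qed
  have dvd: "q dvd g" if g: "ipoly g x = 0" for g
  proof -
    obtain a s where as: "a \<noteq> 0" "Polynomial.smult a g = q * s + pseudo_mod g q"
      and r: "pseudo_mod g q = 0 \<or> degree (pseudo_mod g q) < degree q"
      using pseudo_mod[OF q(1), of g] by blast
    have "ipoly (Polynomial.smult a g) x = ipoly (q * s + pseudo_mod g q) x" using as by simp
    then have "ipoly (pseudo_mod g q) x = 0" using g q by simp
    then have "pseudo_mod g q = 0" using r min q(3) by (metis not_le)
    then have e: "Polynomial.smult a g = q * s" using as by simp
    \<comment> \<open>As \<open>q\<close> is primitive, comparing contents shows that the
      pseudo-division factor \<open>a\<close> divides \<open>s\<close> and can be cancelled.\<close>
    have "\<bar>a\<bar> * content g = content q * content s"
      using arg_cong[OF e, of content] by (simp add: content_mult)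
    then have "a dvd content s" using q(2) by (metis abs_dvd_iff dvd_triv_left mult_1)
    then have "[:a:] dvd s" by (simp add: const_poly_dvd_iff_dvd_content)
    then obtain s' where s': "s = Polynomial.smult a s'" by (auto simp: dvd_def)
    then have "Polynomial.smult a g = Polynomial.smult a (q * s')" using e by simp
    then have "g = q * s'" using as(1) by (simp add: smult_cancel)
    then show ?thesis by simp
  qed
  obtain s where s: "P = q * s" using dvd P by blast
  have "lead_coeff q * lead_coeff s = 1" using P s by (simp add: lead_coeff_mult)
  then have u: "lead_coeff q = 1 \<or> lead_coeff q = -1"
    by (metis zmult_eq_1_iff)
  show ?thesis
  proof (cases "lead_coeff q = 1")
    case True
    then show ?thesis using that[of q] q dvd by (auto simp: int_min_poly_def)
  next
    case False
    then show ?thesis using that[of "-q"] u q dvd by (auto simp: int_min_poly_def)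
  qed
qed

lemma int_min_poly_degree_pos: "int_min_poly f x \<Longrightarrow> degree f > 0"
proof (rule ccontr)
  assume f: "int_min_poly f x" "\<not> degree f > 0"
  then obtain c where "f = [:c:]" by (metis degree_eq_zeroE gr0I)
  with f show False by (auto simp: int_min_poly_def)
qed

lemma algebraic_int_root_of_int_min_poly:
  fixes x :: "'a::field_char_0" and y :: "'b::field_char_0"
  assumes "int_min_poly f x" "ipoly f y = 0"
  shows "algebraic_int y"
  using assms by (auto simp: algebraic_int_altdef_ipoly int_min_poly_def)

lemma monic_dvd_degree_eq:
  fixes f g :: "int poly"
  assumes "lead_coeff f = 1" "lead_coeff g = 1" "f dvd g" "degree g \<le> degree f"
  shows "f = g"
proof -
  obtain k where k: "g = f * k" using assms by auto
  have "k \<noteq> 0" "f \<noteq> 0" using assms k by auto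
  then have "degree k = 0" using k assms by (simp add: degree_mult_eq)
  then obtain c where "k = [:c:]" by (metis degree_eq_zeroE)
  moreover have "lead_coeff k = 1" using k assms by (simp add: lead_coeff_mult)
  ultimately show ?thesis using k by simp
qed

text \<open>Irreducibility: writing \<open>f = h * k\<close> with \<open>h\<close> minimal for
  \<open>y\<close>, the degree of \<open>k\<close> is too small for \<open>k\<close> to vanish at
  \<open>x\<close>, so \<open>h\<close> does and \<open>f = h\<close>.\<close>

lemma int_min_poly_conjugate:
  fixes x :: "'a::field_char_0" and y :: "'b::field_char_0"
  assumes f: "int_min_poly f x" and y: "ipoly f y = 0"
  shows "int_min_poly f y"
proof -
  obtain h where h: "int_min_poly h y"
    using int_min_poly_exists algebraic_int_root_of_int_min_poly[OF f y] by blast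
  obtain k where k: "f = h * k" using h y by (auto simp: int_min_poly_def)
  have nz: "h \<noteq> 0" "k \<noteq> 0" "f \<noteq> 0" using f k by (auto simp: int_min_poly_def)
  have "ipoly h x * ipoly k x = 0" using f k by (auto simp: int_min_poly_def)
  moreover have "ipoly k x \<noteq> 0"
  proof
    assume "ipoly k x = 0"
    then have "f dvd k" using f by (auto simp: int_min_poly_def)
    then have "degree f \<le> degree k" using nz by (intro dvd_imp_degree_le) auto
    then show False using k nz int_min_poly_degree_pos[OF h] by (simp add: degree_mult_eq)
  qed
  ultimately have "f dvd h" using f by (auto simp: int_min_poly_def)
  then have "f = h"
    using f h k nz by (intro monic_dvd_degree_eq) (auto simp: int_min_poly_def degree_mult_eq)
  then show ?thesis using h by simp
qed

text \<open>Separability: a common root of \<open>f\<close> and its derivative would again have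
  \<open>f\<close> as minimal polynomial, so \<open>f\<close> would divide a nonzero polynomial of
  smaller degree.\<close>

lemma int_min_poly_card_roots:
  assumes f: "int_min_poly f x"
  shows "card {y::complex. ipoly f y = 0} = degree f"
proof -
  let ?F = "map_poly of_int f :: complex poly"
  have lc: "lead_coeff ?F = 1" using f by (simp add: int_min_poly_def)
  have "poly (pderiv ?F) y \<noteq> 0" if y: "ipoly f y = 0" for y
  proof
    assume "poly (pderiv ?F) y = 0"
    then have "ipoly (pderiv f) y = 0" by (simp add: of_int_hom.map_poly_pderiv)
    then have "f dvd pderiv f"
      using int_min_poly_conjugate[OF f y] by (auto simp: int_min_poly_def)
    moreover have "pderiv f \<noteq> 0" "degree (pderiv f) < degree f"
      using int_min_poly_degree_pos[OF f] by (auto simp: pderiv_eq_0_iff degree_pderiv)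
    ultimately show False using dvd_imp_degree_le by force
  qed
  then have "rsquarefree ?F" by (auto simp: rsquarefree_roots)
  then have "Polynomial.smult (lead_coeff ?F) (\<Prod>z|poly ?F z = 0. [:-z, 1:]) = ?F"
    by (rule complex_poly_decompose_rsquarefree)
  then have "(\<Prod>z|poly ?F z = 0. [:-z, 1:]) = ?F" using lc by simp
  then have "degree (\<Prod>z|poly ?F z = 0. [:-z, 1:]) = degree f" by simp
  then show ?thesis by (subst (asm) degree_prod_sum_eq) auto
qed

lemma rat_poly_clear_denominators:
  fixes q :: "rat poly"
  obtains c :: int and g where "c \<noteq> 0" "map_poly of_int g = Polynomial.smult (of_int c) q"
proof -
  have "\<exists>c g. c \<noteq> (0::int) \<and> map_poly of_int g = Polynomial.smult (of_int c) q"
  proof (induction q)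
    case 0
    show ?case by (intro exI[of _ 1] exI[of _ 0]) auto
  next
    case (pCons a q)
    then obtain c g where cg: "c \<noteq> 0" "map_poly of_int g = Polynomial.smult (of_int c) q" by blast
    obtain u v where uv: "a = of_int u / of_int v" "v > 0"
      by (metis quotient_of_div quotient_of_denom_pos surj_pair)
    have "map_poly of_int (pCons (c * u) (Polynomial.smult v g))
        = Polynomial.smult (of_int (c * v)) (pCons a q)"
      using uv cg by (simp add: hom_distribs mult.commute)
    moreover have "c * v \<noteq> 0" using cg uv by simp
    ultimately show ?case by blast
  qed
  then show ?thesis using that by blast
qed

text \<open>Clearing denominators makes a rational annihilator an integral one of the same degree,
  which \<open>f\<close> divides.\<close>

lemma int_min_poly_min_poly:
  fixes x :: "'a::field_char_0"
  assumes f: "int_min_poly f x"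
  shows "min_poly x = map_poly of_int f"
proof -
  have "map_poly of_rat (map_poly of_int f :: rat poly) = (map_poly of_int f :: 'a poly)"
    by (simp add: map_poly_map_poly o_def)
  moreover have "degree f \<le> degree q" if q: "q \<noteq> 0" "poly (map_poly of_rat q) x = 0" for q
  proof -
    obtain c g where cg: "c \<noteq> 0" "map_poly of_int g = Polynomial.smult (of_int c) q"
      using rat_poly_clear_denominators by blast
    have "of_int c * poly (map_poly of_rat q) x = poly (map_poly of_rat (Polynomial.smult (of_int c) q)) x"
      by (simp add: hom_distribs)
    also have "\<dots> = ipoly g x" by (simp add: cg(2)[symmetric] map_poly_map_poly o_def)
    finally have "f dvd g" using q f by (auto simp: int_min_poly_def)
    moreover have "g \<noteq> 0" using cg q by auto
    moreover have "degree g = degree q" using arg_cong[OF cg(2), of degree] cg(1) by simp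
    ultimately show ?thesis using dvd_imp_degree_le[of f g] by simp
  qed
  ultimately have "is_min_poly (map_poly of_int f) x"
    using f by (auto simp: is_min_poly_def int_min_poly_def)
  then show ?thesis unfolding min_poly_def using is_min_poly_unique by blast
qed

lemma algebraic_conjugates_int_min_poly:
  assumes "int_min_poly f x"
  shows "algebraic_conjugates x = {y. ipoly f y = 0}"
  by (simp add: algebraic_conjugates_def int_min_poly_min_poly[OF assms] map_poly_map_poly o_def)

section \<open>Conjugates of roots of unity\<close>

text \<open>All inner binomial coefficients are multiples of \<open>p\<close>. Both integers and
  integral polynomials occur as the ring below.\<close>

lemma prime_dvd_add_power:
  fixes x y :: "'a::comm_ring_1"
  assumes "prime p"
  shows "of_nat p dvd (x + y) ^ p - x ^ p - y ^ p"
proof -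
  have p: "p > 0" using assms prime_gt_0_nat by blast
  have "(x + y) ^ p = (\<Sum>k\<le>p. of_nat (p choose k) * x ^ k * y ^ (p - k))"
    by (rule binomial_ring)
  also have "{..p} = insert 0 (insert p {0<..<p})" by auto
  also have "(\<Sum>k\<in>\<dots>. of_nat (p choose k) * x ^ k * y ^ (p - k))
      = y ^ p + x ^ p + (\<Sum>k\<in>{0<..<p}. of_nat (p choose k) * x ^ k * y ^ (p - k))"
    using p by simp
  finally have "(x + y) ^ p - x ^ p - y ^ p
      = (\<Sum>k\<in>{0<..<p}. of_nat (p choose k) * x ^ k * y ^ (p - k))" by simp
  moreover have "of_nat p dvd (of_nat (p choose k) :: 'a)" if "k \<in> {0<..<p}" for k
  proof -
    have "p dvd p choose k" using that assms by (intro dvd_choose_prime) auto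
    then show ?thesis by (auto simp: dvd_def)
  qed
  ultimately show ?thesis by (auto intro!: dvd_sum dvd_mult2)
qed

text \<open>Fermat's little theorem, by induction for natural numbers; reduction modulo
  \<open>p\<close> extends it to all integers.\<close>

lemma prime_dvd_power_minus_self:
  fixes a :: int
  assumes p: "prime p"
  shows "int p dvd a ^ p - a"
proof -
  have *: "int p dvd int r ^ p - int r" for r
  proof (induction r)
    case 0
    show ?case using p prime_gt_0_nat[of p] by (simp add: power_0_left)
  next
    case (Suc r)
    have "int (Suc r) ^ p - int (Suc r)
        = ((int r + 1) ^ p - int r ^ p - 1 ^ p) + (int r ^ p - int r)" by (simp add: add.commute)
    then show ?case using Suc prime_dvd_add_power[OF p, of "int r" 1] by (metis dvd_add)
  qed
  have "p > 0" using p prime_gt_0_nat by blast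
  then have r: "int (nat (a mod int p)) = a mod int p" by simp
  have "[(a mod int p) ^ p = a mod int p] (mod int p)"
    using *[of "nat (a mod int p)"] unfolding r by (simp add: cong_iff_dvd_diff)
  then have "[a ^ p = a] (mod int p)" by (simp add: cong_def power_mod)
  then show ?thesis by (simp add: cong_iff_dvd_diff)
qed

text \<open>Modulo \<open>p\<close>, taking \<open>p\<close>-th powers is additive and
  multiplicative and fixes the integer coefficients, so only the indeterminate is affected.\<close>

lemma prime_dvd_pcompose_power:
  fixes g :: "int poly"
  assumes p: "prime p"
  shows "of_nat p dvd pcompose g (Polynomial.monom 1 p) - g ^ p"
proof (induction g)
  case 0
  show ?case using p prime_gt_0_nat[of p] by (simp add: power_0_left)
next
  case (pCons a g)
  let ?X = "[:0, 1:] :: int poly"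
  have e: "pCons a g = [:a:] + ?X * g" by simp
  have Xp: "?X ^ p = Polynomial.monom 1 p" by (simp add: monom_altdef)
  have "[:int p:] dvd [:a - a ^ p:]"
    using prime_dvd_power_minus_self[OF p, of a] by (metis const_poly_dvd dvd_minus_iff minus_diff_eq)
  then have a: "of_nat p dvd [:a:] - [:a:] ^ p"
    by (simp add: of_nat_poly poly_const_pow)
  have "pcompose (pCons a g) (Polynomial.monom 1 p) - (pCons a g) ^ p
     = ([:a:] - [:a:] ^ p) + ?X ^ p * (pcompose g (Polynomial.monom 1 p) - g ^ p)
       - (([:a:] + ?X * g) ^ p - [:a:] ^ p - (?X * g) ^ p)"
    by (subst (2) e, simp only: power_mult_distrib Xp) (simp add: pcompose_pCons right_diff_distrib)
  also have "of_nat p dvd \<dots>"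
    using a pCons.IH prime_dvd_add_power[OF p, of "[:a:]" "?X * g"] 
    by (metis dvd_add dvd_diff dvd_mult)
  finally show ?case .
qed

text \<open>
  Otherwise \<open>z ^ p\<close> is a root of the cofactor \<open>g\<close> of \<open>f\<close> in \<open>X ^ n - 1\<close>. As \<open>g (X ^ p) = g ^ p\<close>
  modulo \<open>p\<close>, this makes \<open>g z ^ p\<close> a multiple of \<open>p\<close> in the integral extension by \<open>z\<close>;
  multiplying by powers of \<open>f' z\<close> and \<open>z\<close> turns it into \<open>n ^ p\<close>, so \<open>p\<close> divides \<open>n\<close>.
\<close>

lemma root_of_unity_prime_power_conjugate:
  fixes z :: "'a::field_char_0"
  assumes f: "int_min_poly f z" and z: "z ^ n = 1" and n: "n > 0"
    and p: "prime p" "\<not> p dvd n"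
  shows "ipoly f (z ^ p) = 0"
proof (rule ccontr)
  assume nz: "ipoly f (z ^ p) \<noteq> 0"
  have "ipoly (Polynomial.monom 1 n - 1) z = 0" using z by (simp add: poly_monom)
  then have "f dvd Polynomial.monom 1 n - 1" using f unfolding int_min_poly_def by blast
  then obtain g where g: "Polynomial.monom 1 n - 1 = f * g" by blast
  have "ipoly f (z ^ p) * ipoly g (z ^ p) = ipoly (Polynomial.monom 1 n - 1) (z ^ p)"
    unfolding g by simp
  also have "\<dots> = (z ^ n) ^ p - 1" by (simp add: poly_monom flip: power_mult) (simp add: mult.commute)
  finally have g0: "ipoly g (z ^ p) = 0" using nz z by simp
  obtain h where h: "pcompose g (Polynomial.monom 1 p) - g ^ p = of_nat p * h"
    using prime_dvd_pcompose_power[OF p(1)] by (auto simp: dvd_def)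
  have "- (ipoly g z ^ p) = of_nat p * ipoly h z"
    using arg_cong[OF h, of "\<lambda>q. ipoly q z"] g0
    by (simp add: hom_distribs poly_pcompose poly_monom)
  then have gp: "ipoly g z ^ p = - (of_nat p * ipoly h z)" by (metis minus_minus)
  have "pderiv (Polynomial.monom 1 n - 1 :: int poly) = Polynomial.monom (of_nat n) (n - 1)"
    by (simp add: pderiv_diff pderiv_monom)
  then have "Polynomial.monom (of_nat n) (n - 1) = f * pderiv g + g * pderiv f"
    unfolding g by (simp add: pderiv_mult)
  from arg_cong[OF this, of "\<lambda>q. ipoly q z"]
  have d: "of_nat n * z ^ (n - 1) = ipoly g z * ipoly (pderiv f) z"
    using f by (simp add: int_min_poly_def poly_monom)
  define H where "H = - h * pderiv f ^ p * Polynomial.monom 1 p"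
  have "of_nat p * ipoly H z = (ipoly g z * ipoly (pderiv f) z) ^ p * z ^ p"
    by (simp add: H_def power_mult_distrib gp poly_monom)
  also have "\<dots> = of_nat n ^ p * (z ^ (n - 1) * z) ^ p" by (simp flip: d add: power_mult_distrib)
  also have "z ^ (n - 1) * z = 1" using n z by (simp flip: power_Suc2)
  finally have pH: "of_nat p * ipoly H z = of_nat n ^ p" by simp
  \<comment> \<open>With \<open>H\<close> replaced by its remainder \<open>R\<close>, the polynomial
    \<open>p * R - n ^ p\<close> vanishes at \<open>z\<close> and has degree below that of
    \<open>f\<close>, so it is zero; its constant coefficient gives the divisibility.\<close>
  have "lead_coeff f = 1" using f by (simp add: int_min_poly_def)
  then obtain s R where R: "H = f * s + R" "R = 0 \<or> degree R < degree f"
    by (rule monic_int_division)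
  let ?D = "Polynomial.smult (int p) R - [:int n ^ p:]"
  have "ipoly ?D z = 0" using pH R f by (simp add: int_min_poly_def hom_distribs)
  then have "f dvd ?D" using f by (auto simp: int_min_poly_def)
  moreover have "degree ?D < degree f"
    using R(2) int_min_poly_degree_pos[OF f]
    by (intro le_less_trans[OF degree_diff_le_max]) (auto intro: le_less_trans[OF degree_smult_le])
  ultimately have "?D = 0" by (metis dvd_imp_degree_le not_le)
  then have "coeff ?D 0 = 0" by simp
  then have "int p * coeff R 0 = int n ^ p" by simp
  then have "int p dvd int (n ^ p)" by (metis dvd_triv_left of_nat_power)
  then have "p dvd n" using p(1) prime_dvd_power int_dvd_int_iff by blast
  then show False using p by simp
qed

text \<open>Prime factors of \<open>j\<close> are removed one at a time: \<open>z ^ p\<close> has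
  the same minimal polynomial \<open>f\<close> and takes the place of \<open>z\<close>, which is why
  the induction leaves \<open>z\<close> arbitrary.\<close>

lemma root_of_unity_coprime_power_conjugate:
  fixes z :: "'a::field_char_0"
  assumes "int_min_poly f z" "z ^ n = 1" "n > 0" "j > 0" "coprime j n"
  shows "ipoly f (z ^ j) = 0"
  using assms
proof (induction j arbitrary: z rule: less_induct)
  case (less j)
  show ?case
  proof (cases "j = 1")
    case True
    then show ?thesis using less by (simp add: int_min_poly_def)
  next
    case False
    then obtain p where p: "prime p" "p dvd j" using prime_factor_nat by blast
    then obtain i where j: "j = p * i" by auto
    have "\<not> p dvd n" using p less.prems(5) by (metis coprime_common_divisor not_prime_unit)
    then have "ipoly f (z ^ p) = 0"
      using root_of_unity_prime_power_conjugate less.prems p by blast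
    then have "int_min_poly f (z ^ p)" using int_min_poly_conjugate less.prems by blast
    moreover have "(z ^ p) ^ n = 1" using less.prems by (metis power_mult mult.commute power_one)
    moreover have "i < j" "i > 0" "coprime i n"
      using less.prems p prime_gt_1_nat[of p] by (auto simp: j)
    ultimately have "ipoly f ((z ^ p) ^ i) = 0" using less.IH less.prems(3) by blast
    then show ?thesis by (simp add: j power_mult)
  qed
qed

section \<open>Kronecker's theorem on an interval\<close>

text \<open>The Chebyshev polynomials of the first kind in the scaling
  \<open>2 * T_n (X / 2)\<close>: they send \<open>2 cos t\<close> to
  \<open>2 cos (n t)\<close>.\<close>

fun cos_poly :: "nat \<Rightarrow> int poly" where
  "cos_poly 0 = [:2:]"
| "cos_poly (Suc 0) = [:0, 1:]"
| "cos_poly (Suc (Suc n)) = [:0, 1:] * cos_poly (Suc n) - cos_poly n"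

lemma cos_poly_plus_inverse:
  fixes z :: "'a::field_char_0"
  assumes "z \<noteq> 0"
  shows "ipoly (cos_poly k) (z + inverse z) = z ^ k + inverse z ^ k"
  using assms by (induction k rule: cos_poly.induct) (simp_all add: hom_distribs field_simps)

lemma cis_plus_inverse: "cis t + inverse (cis t) = of_real (2 * cos t)"
  by (simp add: complex_eq_iff)

lemma norm_cos_poly_le_2:
  fixes y :: real
  assumes "\<bar>y\<bar> \<le> 2"
  shows "cmod (ipoly (cos_poly k) (of_real y)) \<le> 2"
proof -
  let ?z = "cis (arccos (y / 2))"
  have "of_real y = ?z + inverse ?z" using assms by (subst cis_plus_inverse) (simp add: cos_arccos_abs)
  then have "ipoly (cos_poly k) (of_real y) = ?z ^ k + inverse ?z ^ k"
    using cos_poly_plus_inverse[of ?z] by simp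
  also have "cmod \<dots> \<le> cmod (?z ^ k) + cmod (inverse ?z ^ k)" by (rule norm_triangle_ineq)
  also have "\<dots> = 2" by (simp add: norm_power norm_inverse)
  finally show ?thesis .
qed

text \<open>Lagrange interpolation, with basis \<open>L\<close>, makes the coefficients linear in
  the values, so \<open>B\<close> depends only on \<open>Y\<close> and \<open>M\<close> and is fixed
  before \<open>p\<close> and \<open>i\<close>.\<close>

lemma coeff_bounded_by_values:
  fixes Y :: "'a::real_normed_field set"
  assumes Y: "finite Y"
  obtains B where "\<And>p i. degree p < card Y \<Longrightarrow> (\<And>y. y \<in> Y \<Longrightarrow> norm (poly p y) \<le> M) \<Longrightarrow>
    norm (coeff p i) \<le> B"
proof -
  define L where "L y =
    Polynomial.smult (inverse (\<Prod>w\<in>Y - {y}. y - w)) (\<Prod>w\<in>Y - {y}. [:-w, 1:])" for y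
  have L: "poly (L y) u = (if u = y then 1 else 0)" if "y \<in> Y" "u \<in> Y" for y u
    using that Y by (auto simp: L_def poly_prod)
  have dL: "degree (L y) < card Y" if "y \<in> Y" for y
  proof -
    have "degree (L y) \<le> degree (\<Prod>w\<in>Y - {y}. [:-w, 1:])" unfolding L_def by (rule degree_smult_le)
    also have "\<dots> = card (Y - {y})" by (subst degree_prod_sum_eq) auto
    also have "\<dots> < card Y" using that Y by (rule card_Diff1_less[rotated])
    finally show ?thesis .
  qed
  define B where "B = (\<Sum>y\<in>Y. \<bar>M\<bar> * (\<Sum>i<card Y. norm (coeff (L y) i)))"
  show ?thesis
  proof (rule that[of B])
    fix p i assume dp: "degree p < card Y" and M: "\<And>y. y \<in> Y \<Longrightarrow> norm (poly p y) \<le> M"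
    have p: "p = (\<Sum>y\<in>Y. Polynomial.smult (poly p y) (L y))"
    proof (rule poly_eqI_degree[of Y])
      fix u assume "u \<in> Y"
      then show "poly p u = poly (\<Sum>y\<in>Y. Polynomial.smult (poly p y) (L y)) u"
        using Y by (simp add: poly_sum L if_distrib cong: if_cong sum.cong)
    next
      have "degree (\<Sum>y\<in>Y. Polynomial.smult (poly p y) (L y)) \<le> card Y - 1"
        using dL by (intro degree_sum_le Y order.trans[OF degree_smult_le]) (fastforce simp: less_eq_Suc_le)
      then show "degree (\<Sum>y\<in>Y. Polynomial.smult (poly p y) (L y)) < card Y" using dp by linarith
    qed (use dp in auto)
    have c: "norm (coeff (L y) i) \<le> (\<Sum>i<card Y. norm (coeff (L y) i))" if "y \<in> Y" for y
    proof (cases "i < card Y")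
      case True
      then show ?thesis by (intro member_le_sum) auto
    next
      case False
      then have "coeff (L y) i = 0" using dL[OF that] by (intro coeff_eq_0) auto
      then show ?thesis by (simp add: sum_nonneg)
    qed
    have "norm (coeff p i) = norm (\<Sum>y\<in>Y. poly p y * coeff (L y) i)"
      by (subst p) (simp add: coeff_sum)
    also have "\<dots> \<le> (\<Sum>y\<in>Y. norm (poly p y) * norm (coeff (L y) i))"
      by (rule order.trans[OF norm_sum]) (simp add: norm_mult)
    also have "\<dots> \<le> B" unfolding B_def
      using M c by (intro sum_mono mult_mono) (auto intro: order.trans[OF _ abs_ge_self])
    finally show "norm (coeff p i) \<le> B" .
  qed
qed

lemma finite_bounded_int_polys: "finite {p :: int poly. degree p < d \<and> (\<forall>i. \<bar>coeff p i\<bar> \<le> B)}"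
proof (rule finite_imageD)
  have "coeffs ` {p. degree p < d \<and> (\<forall>i. \<bar>coeff p i\<bar> \<le> B)}
      \<subseteq> {xs. set xs \<subseteq> {-B..B} \<and> length xs \<le> d}"
    by (auto simp: length_coeffs coeffs_def abs_le_iff minus_le_iff split: if_splits)
  then show "finite (coeffs ` {p. degree p < d \<and> (\<forall>i. \<bar>coeff p i\<bar> \<le> B)})"
    using finite_lists_length_le[of "{-B..B}" d] finite_subset by blast
qed (auto intro!: inj_onI simp: coeffs_eq_iff)

text \<open>
  With \<open>x = 2 cos t\<close>, the numbers \<open>2 cos (k t)\<close> and their conjugates are bounded by 2, so by
  interpolation at the conjugates of \<open>x\<close> only finitely many polynomials of degree less than
  \<open>degree f\<close> represent them; hence two of them coincide.
\<close>

lemma kronecker_interval: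
  fixes x :: real
  assumes f: "int_min_poly f x"
    and bd: "\<And>y::complex. ipoly f y = 0 \<Longrightarrow> y \<in> \<real> \<and> cmod y \<le> 2"
  obtains z :: complex and n where "n > 0" "z ^ n = 1" "of_real x = z + inverse z"
proof -
  let ?Y = "{y::complex. ipoly f y = 0}"
  have lc: "lead_coeff f = 1" using f by (simp add: int_min_poly_def)
  have fx: "ipoly f (of_real x :: complex) = 0"
    using f by (simp add: ipoly_of_real int_min_poly_def)
  have "map_poly of_int f \<noteq> (0 :: complex poly)" using lc by auto
  then have fin: "finite ?Y" by (rule poly_roots_finite)
  \<comment> \<open>The remainders modulo \<open>f\<close> agree with \<open>cos_poly k\<close> at
    every root of \<open>f\<close>. A zero remainder fits the degree bound because
    \<open>degree f\<close> is positive.\<close>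
  have "\<exists>r. \<exists>q. cos_poly k = f * q + r \<and> degree r < degree f" for k
    using monic_int_division[OF lc, of "cos_poly k"] int_min_poly_degree_pos[OF f]
    by (metis degree_0)
  then obtain R where R: "\<And>k. \<exists>q. cos_poly k = f * q + R k" "\<And>k. degree (R k) < degree f"
    by metis
  have val: "ipoly (R k) y = ipoly (cos_poly k) y" if "y \<in> ?Y" for k y
    using R(1)[of k] that by auto
  obtain B where B: "\<And>p i. degree p < card ?Y \<Longrightarrow> (\<And>y. y \<in> ?Y \<Longrightarrow> cmod (poly p y) \<le> 2) \<Longrightarrow>
    cmod (coeff p i) \<le> B"
    using coeff_bounded_by_values[OF fin] by blast
  have le: "\<bar>coeff (R k) i\<bar> \<le> \<lceil>B\<rceil>" for k i
  proof -
    have "cmod (ipoly (R k) y) \<le> 2" if "y \<in> ?Y" for y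
    proof -
      have "y \<in> \<real>" "cmod y \<le> 2" using bd[of y] that by auto
      then obtain t where "y = of_real t" "\<bar>t\<bar> \<le> 2" by (auto elim!: Reals_cases)
      then show ?thesis using val[OF that] norm_cos_poly_le_2 by simp
    qed
    then have "cmod (coeff (map_poly of_int (R k)) i) \<le> B"
      using R(2) int_min_poly_card_roots[OF f] by (intro B) auto
    then show ?thesis by (simp add: coeff_map_poly) linarith
  qed
  have "range R \<subseteq> {p. degree p < degree f \<and> (\<forall>i. \<bar>coeff p i\<bar> \<le> \<lceil>B\<rceil>)}" using le R by auto
  then have "finite (range R)" using finite_bounded_int_polys finite_subset by blast
  then have "\<not> inj R" using finite_imageD infinite_UNIV_nat by blast
  then obtain k l where kl: "k < l" "R k = R l" by (metis injI linorder_neqE_nat)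
  define z where "z = cis (arccos (x / 2))"
  have "\<bar>x\<bar> \<le> 2" using bd[OF fx] by simp
  then have x: "of_real x = z + inverse z"
    unfolding z_def by (subst cis_plus_inverse) (simp add: cos_arccos_abs)
  have z0: "z \<noteq> 0" by (simp add: z_def)
  have "z ^ k + inverse z ^ k = z ^ l + inverse z ^ l"
    using val[of "of_real x" k] val[of "of_real x" l] kl fx cos_poly_plus_inverse[OF z0] by (simp add: x)
  then have "z ^ l * (z ^ k + inverse z ^ k) = z ^ l * (z ^ l + inverse z ^ l)" by simp
  moreover have l: "z ^ l = z ^ (l - k) * z ^ k" using kl by (simp flip: power_add)
  moreover have "z ^ k * inverse z ^ k = 1" "z ^ l * inverse z ^ l = 1"
    using z0 by (simp_all flip: power_mult_distrib)
  \<comment> \<open>Here \<open>a = z ^ k\<close>, \<open>b = z ^ (l - k)\<close>, and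
    \<open>i\<close>, \<open>j\<close> are the inverses of \<open>z ^ k\<close>,
    \<open>z ^ l\<close>. The equality of the two sums factors, so \<open>z ^ (l + k)\<close> or
    \<open>z ^ (l - k)\<close> is 1.\<close>
  moreover have "(b * a * a - 1) * (b - 1) = 0"
    if "b * a * (a + i) = b * a * (b * a + j)" "a * i = 1" "b * a * j = 1" for a b i j :: complex
  proof -
    have "b * a * a + b * (a * i) = (b * a) * (b * a) + b * a * j"
      using that(1) by (simp add: algebra_simps)
    then show ?thesis using that by (simp add: algebra_simps)
  qed
  ultimately have "(z ^ (l - k) * z ^ k * z ^ k - 1) * (z ^ (l - k) - 1) = 0" by metis
  then have "(z ^ (l + k) - 1) * (z ^ (l - k) - 1) = 0" unfolding power_add l .
  then consider "z ^ (l + k) = 1" | "z ^ (l - k) = 1" by auto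
  then show ?thesis
    using that[of "l + k" z] that[of "l - k" z] kl x by cases auto
qed

section \<open>Maximal conjugates in the interval from 0 to 2\<close>

text \<open>Multiplying \<open>f (w + 1 / w)\<close> by \<open>w ^ d\<close> gives an integral
  polynomial \<open>P\<close> in \<open>w\<close>; it vanishes at \<open>z\<close>, hence at the
  conjugate \<open>z ^ j\<close>.\<close>

lemma root_of_unity_plus_inverse_conjugate:
  fixes z :: "'a::field_char_0"
  assumes f: "ipoly f (z + inverse z) = 0" and z: "z ^ n = 1" "n > 0" and j: "j > 0" "coprime j n"
  shows "ipoly f (z ^ j + inverse (z ^ j)) = 0"
proof -
  define d where "d = degree f"
  define P where "P = (\<Sum>i\<le>d. Polynomial.smult (coeff f i) (monom 1 (d - i) * (monom 1 2 + 1) ^ i))"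
  have P: "ipoly P w = w ^ d * ipoly f (w + inverse w)" if "w \<noteq> 0" for w :: 'a
  proof -
    have "ipoly P w = (\<Sum>i\<le>d. of_int (coeff f i) * (w ^ (d - i) * (w ^ 2 + 1) ^ i))"
      unfolding P_def by (simp add: of_int_poly_hom.hom_sum poly_sum poly_monom)
    also have "\<dots> = (\<Sum>i\<le>d. w ^ d * (of_int (coeff f i) * (w + inverse w) ^ i))"
    proof (rule sum.cong)
      fix i assume "i \<in> {..d}"
      then have "w ^ d = w ^ (d - i) * w ^ i" by (simp flip: power_add)
      moreover have "w ^ i * (w + inverse w) ^ i = (w ^ 2 + 1) ^ i"
        using that by (simp flip: power_mult_distrib) (simp add: distrib_left power2_eq_square)
      ultimately show "of_int (coeff f i) * (w ^ (d - i) * (w ^ 2 + 1) ^ i)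
          = w ^ d * (of_int (coeff f i) * (w + inverse w) ^ i)" by (simp add: mult_ac)
    qed simp
    also have "\<dots> = w ^ d * ipoly f (w + inverse w)"
      by (simp add: poly_altdef d_def sum_distrib_left)
    finally show ?thesis .
  qed
  have z0: "z \<noteq> 0" using z by (intro notI) (simp add: power_0_left)
  have "algebraic_int z"
  proof (rule algebraic_int_root[of 1])
    show "poly (monom 1 n) z = 1" using z by (simp add: poly_monom)
    show "\<forall>i. coeff (monom 1 n) i \<in> (\<int> :: 'a set)" by simp
  qed (use z in \<open>simp_all add: degree_monom_eq\<close>)
  then obtain h where h: "int_min_poly h z" using int_min_poly_exists by blast
  have "ipoly P z = 0" using P[OF z0] f by simp
  then have "h dvd P" using h by (auto simp: int_min_poly_def)
  then have "ipoly P (z ^ j) = 0"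
    using root_of_unity_coprime_power_conjugate[OF h z j] by (auto simp: dvd_def)
  then show ?thesis using P[of "z ^ j"] z0 by simp
qed

text \<open>Reducing the exponent fraction to lowest terms exhibits \<open>z\<close> as a primitive
  \<open>n\<close>-th root of unity; \<open>k = 0\<close> then forces \<open>n = 1\<close>.\<close>

lemma root_of_unity_cis:
  assumes "z ^ N = 1" "N > 0"
  obtains k n :: nat where "n > 0" "k < n" "coprime k n" "z = cis (2 * pi * k / n)"
proof -
  have "z \<in> {z. z ^ N = 1}" using assms by simp
  then obtain j where j: "j < N" "z = cis (2 * pi * j / N)"
    using bij_betw_roots_unity[OF assms(2)] by (auto simp: bij_betw_def)
  define g where "g = gcd j N"
  have g: "g > 0" using assms by (simp add: g_def)
  have "\<exists>k n. j = k * g \<and> N = n * g \<and> coprime k n"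
    unfolding g_def by (rule gcd_coprime_exists) (use assms in simp)
  then obtain k n where kn: "j = k * g" "N = n * g" "coprime k n" by blast
  show ?thesis
  proof (rule that[of n k])
    show "n > 0" "k < n" "coprime k n" using kn j assms by auto
    show "z = cis (2 * pi * k / n)" using j kn g by (simp add: field_simps)
  qed
qed

text \<open>Replacing \<open>k\<close> by \<open>n - k\<close> if necessary brings the angle into
  \<open>[0, pi]\<close>, where the cosine decreases.\<close>

lemma cos_multiple_le:
  assumes "1 \<le> k" "k < n"
  shows "cos (2 * pi * real k / real n) \<le> cos (2 * pi / real n)"
proof (cases "2 * k \<le> n")
  case True
  have "real (2 * k) \<le> real n" using True by (simp only: of_nat_le_iff)
  then show ?thesis using assms by (intro cos_monotone_0_pi_le) (auto simp: field_simps)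
next
  case False
  have "cos (2 * pi * real k / real n) = cos (2 * pi - 2 * pi * real k / real n)"
    by (simp add: cos_diff)
  also have "\<dots> = cos (2 * pi * real (n - k) / real n)"
    using assms by (simp add: of_nat_diff field_simps)
  also have "\<dots> \<le> cos (2 * pi / real n)"
  proof -
    have "real (2 * (n - k)) \<le> real n" using False by (intro of_nat_mono) auto
    then have "2 * pi * real (n - k) / real n \<le> pi" using assms by (simp add: field_simps)
    moreover have "2 * pi * 1 / real n \<le> 2 * pi * real (n - k) / real n"
      using assms by (intro divide_right_mono mult_left_mono) auto
    ultimately show ?thesis by (intro cos_monotone_0_pi_le) auto
  qed
  finally show ?thesis .
qed

text \<open>With \<open>x = 2 cos (2 pi k / n)\<close> in lowest terms, every
  \<open>2 cos (2 pi i / n)\<close> with \<open>i\<close> prime to \<open>n\<close> is a conjugate.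
  Unless \<open>x = 2\<close>, taking \<open>i = 1\<close> yields
  \<open>x = 2 cos (2 pi / n)\<close>; for odd \<open>n\<close>, \<open>i = (n - 1) / 2\<close>
  yields \<open>- 2 cos (pi / n)\<close>, too large in modulus, so \<open>n\<close> is even.\<close>

lemma max_conjugate_le_2_cases:
  fixes x :: real
  assumes f: "int_min_poly f x" and x: "0 < x" "x \<le> 2"
    and bd: "\<And>y::complex. ipoly f y = 0 \<Longrightarrow> y \<in> \<real> \<and> cmod y \<le> x"
  shows "x = 2 \<or> (\<exists>m\<ge>3. x = 2 * cos (pi / real m))"
proof -
  have "\<And>y::complex. ipoly f y = 0 \<Longrightarrow> y \<in> \<real> \<and> cmod y \<le> 2" using bd x(2) by force
  then obtain z :: complex and N where N: "N > 0" "z ^ N = 1" "of_real x = z + inverse z"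
    by (rule kronecker_interval[OF f])
  obtain k n :: nat where n: "n > 0" "k < n" "coprime k n" and z: "z = cis (2 * pi * k / n)"
    by (rule root_of_unity_cis[OF N(2,1)])
  have zn: "z ^ n = 1" using assms n unfolding z by (subst DeMoivre) (simp add: cis_multiple_2pi)
  have xk: "x = 2 * cos (2 * pi * k / n)"
    using N(3) unfolding z cis_plus_inverse of_real_eq_iff .
  have fz: "ipoly f (z + inverse z) = 0"
    using f by (simp add: int_min_poly_def ipoly_of_real flip: N(3))
  have conj: "\<bar>2 * cos (2 * pi * i / n)\<bar> \<le> x" if i: "coprime i n" for i :: nat
  proof -
    \<comment> \<open>An inverse \<open>j'\<close> of \<open>k\<close> modulo \<open>n\<close> makes
      \<open>k * j\<close> congruent to the desired \<open>i\<close>; the summand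
      \<open>n * n\<close> only makes the exponent \<open>j\<close> positive.\<close>
    obtain j' where j': "[k * j' = 1] (mod n)" using cong_solve_coprime_nat[OF n(3)] by auto
    define j where "j = j' * i + n * n"
    have "[k * j = k * j' * i + 0] (mod n)" 
      by (simp add: j_def cong_def distrib_left mult.assoc) (simp add: mod_add_eq flip: mult.assoc)
    moreover have "[k * j' * i + 0 = 1 * i + 0] (mod n)" using j' by (intro cong_add cong_mult) auto
    ultimately have kj: "[k * j = i] (mod n)" by (auto intro: cong_trans)
    have "coprime (k * j) n" using kj i by (metis cong_imp_coprime cong_sym)
    then have j: "coprime j n" "j > 0" using n by (auto simp: j_def)
    have "z ^ j = cis (2 * pi / n) ^ (k * j)"
      by (simp add: z DeMoivre mult_ac)
    also have "\<dots> = cis (2 * pi / n) ^ i"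
    proof -
      have c1: "cis (2 * pi / n) ^ n = 1" using n by (simp add: DeMoivre)
      have "cis (2 * pi / n) ^ m = cis (2 * pi / n) ^ (m mod n)" for m
        by (subst div_mult_mod_eq[of m n, symmetric], subst power_add)
          (simp only: mult.commute[of _ n] power_mult c1 power_one mult_1)
      then show ?thesis using kj by (metis cong_def)
    qed
    also have "\<dots> = cis (2 * pi * i / n)" by (simp add: DeMoivre mult_ac)
    finally have "ipoly f (of_real (2 * cos (2 * pi * i / n)) :: complex) = 0"
      using root_of_unity_plus_inverse_conjugate[OF fz zn n(1) j(2,1)] cis_plus_inverse by metis
    from bd[OF this] show ?thesis by (metis norm_of_real)
  qed
  show ?thesis
  proof (cases "k = 0")
    case True
    then show ?thesis using xk by simp
  next
    case False
    have "2 * cos (2 * pi / n) \<le> x" using conj[of 1] by simp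
    moreover have "x \<le> 2 * cos (2 * pi / n)" using cos_multiple_le[of k n] False n xk by simp
    ultimately have x1: "x = 2 * cos (2 * pi / n)" by simp
    have "n > 1" using n False by auto
    show ?thesis
    proof (cases "even n")
      case True
      then obtain m where m: "n = 2 * m" by auto
      \<comment> \<open>\<open>m = 1\<close> and \<open>m = 2\<close> would give
        \<open>x = -2\<close> and \<open>x = 0\<close>.\<close>
      have "m \<noteq> 1" "m \<noteq> 2" "m \<noteq> 0" using x1 x m n by auto
      then have "m \<ge> 3" by auto
      then show ?thesis using x1 m by auto
    next
      case False
      then obtain l where l: "n = 2 * l + 1" by (metis oddE)
      have "coprime l n" unfolding l by (rule coprimeI) (metis dvd_add_right_iff dvd_mult)
      then have "\<bar>2 * cos (2 * pi * l / n)\<bar> \<le> x" using conj by blast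
      moreover have "2 * pi * l / n = pi - pi / n" using n by (simp add: l field_simps)
      ultimately have "cos (pi / n) \<le> cos (2 * pi / n)" using x1 by (simp add: cos_diff)
      moreover have "cos (2 * pi / n) < cos (pi / n)"
        using \<open>n > 1\<close> by (intro cos_monotone_0_pi) (auto simp: field_simps)
      ultimately show ?thesis by simp
    qed
  qed
qed

section \<open>Eigenvalues of adjacency matrices\<close>

text \<open>Functions on the vertices avoid the indexing of the matrix; both real and complex
  eigenvalues are needed.\<close>

definition adjacency_eigenvector ::
  "'v set \<Rightarrow> ('v \<times> 'v) set \<Rightarrow> 'a::field \<Rightarrow> ('v \<Rightarrow> 'a) \<Rightarrow> bool" where
  "adjacency_eigenvector V E c f \<longleftrightarrow>
     (\<exists>v\<in>V. f v \<noteq> 0) \<and> (\<forall>v\<in>V. (\<Sum>w\<in>V. of_bool ((v, w) \<in> E) * f w) = c * f v)"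

definition adjacency_mat :: "'v::linorder set \<Rightarrow> ('v \<times> 'v) set \<Rightarrow> 'a::comm_ring_1 mat" where
  "adjacency_mat V E = mat (card V) (card V)
     (\<lambda>(i, j). of_bool ((sorted_list_of_set V ! i, sorted_list_of_set V ! j) \<in> E))"

lemma adjacency_mat_carrier [simp]: "adjacency_mat V E \<in> carrier_mat (card V) (card V)"
  by (simp add: adjacency_mat_def)

lemma adjacency_matrix_eq: "adjacency_matrix G = adjacency_mat (pverts G) (parcs G)"
  by (auto simp: adjacency_matrix_def adjacency_mat_def Let_def intro!: cong_mat)

lemma eigenvalue_adjacency_mat_iff:
  fixes c :: "'a::field"
  assumes V: "finite V"
  shows "eigenvalue (adjacency_mat V E) c \<longleftrightarrow> (\<exists>f. adjacency_eigenvector V E c f)"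
proof -
  define vs where "vs = sorted_list_of_set V"
  define n where "n = card V"
  have b: "bij_betw ((!) vs) {0..<n} V"
    using V by (intro bij_betw_nth) (auto simp: vs_def n_def)
  have mem: "vs ! i \<in> V" if "i < n" for i using bij_betw_apply[OF b] that by simp
  have ex: "\<exists>i<n. v = vs ! i" if "v \<in> V" for v
    using b that by (metis bij_betw_def imageE atLeastLessThan_iff)
  have sum: "(\<Sum>w\<in>V. F w) = (\<Sum>i = 0..<n. F (vs ! i))" for F :: "'b \<Rightarrow> 'a"
    by (rule sum.reindex_bij_betw[OF b, symmetric])
  have mult: "(adjacency_mat V E *\<^sub>v u) $ i = (\<Sum>w\<in>V. of_bool ((vs ! i, w) \<in> E) * f w)"
    if "u \<in> carrier_vec n" "i < n" "\<And>j. j < n \<Longrightarrow> u $ j = f (vs ! j)" for u i and f :: "'b \<Rightarrow> 'a"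
    unfolding sum using that
    by (auto simp: adjacency_mat_def scalar_prod_def vs_def n_def intro!: sum.cong)
  have iff: "eigenvector (adjacency_mat V E) u c \<longleftrightarrow> adjacency_eigenvector V E c f"
    if u: "u \<in> carrier_vec n" and uf: "\<And>j. j < n \<Longrightarrow> u $ j = f (vs ! j)" for u and f :: "'b \<Rightarrow> 'a"
  proof -
    have d: "dim_row (adjacency_mat V E) = n" by (simp add: adjacency_mat_def n_def)
    have "u \<noteq> 0\<^sub>v n \<longleftrightarrow> (\<exists>v\<in>V. f v \<noteq> 0)"
      using u uf mem ex by (auto simp: vec_eq_iff) (metis)
    moreover have "adjacency_mat V E *\<^sub>v u = c \<cdot>\<^sub>v u \<longleftrightarrow>
        (\<forall>i<n. (\<Sum>w\<in>V. of_bool ((vs ! i, w) \<in> E) * f w) = c * f (vs ! i))"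
      using u uf d mult[OF u _ uf] by (auto simp: vec_eq_iff)
    ultimately show ?thesis
      unfolding eigenvector_def adjacency_eigenvector_def d using u mem ex by blast
  qed
  show ?thesis
  proof
    assume "eigenvalue (adjacency_mat V E) c"
    then obtain u where u: "eigenvector (adjacency_mat V E) u c" by (auto simp: eigenvalue_def)
    then have "u \<in> carrier_vec n" by (simp add: eigenvector_def adjacency_mat_def n_def)
    moreover have "u $ j = u $ inv_into {0..<n} ((!) vs) (vs ! j)" if "j < n" for j
      using b that by (simp add: bij_betw_def)
    ultimately show "\<exists>f. adjacency_eigenvector V E c f"
      using iff[of u "\<lambda>v. u $ inv_into {0..<n} ((!) vs) v"] u by blast
  next
    assume "\<exists>f. adjacency_eigenvector V E c f"
    then obtain f where "adjacency_eigenvector V E c f" by blast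
    then have "eigenvector (adjacency_mat V E) (vec n (\<lambda>i. f (vs ! i))) c"
      by (subst iff[of _ f]) auto
    then show "eigenvalue (adjacency_mat V E) c" by (auto simp: eigenvalue_def)
  qed
qed

text \<open>A single monic integral polynomial has all real and complex eigenvalues as its roots, so
  conjugates of eigenvalues are again eigenvalues.\<close>

lemma char_poly_adjacency_mat:
  "char_poly (adjacency_mat V E :: 'a::{comm_ring_1,ring_char_0} mat)
     = map_poly of_int (char_poly (adjacency_mat V E :: int mat))"
proof -
  have "(adjacency_mat V E :: 'a mat) = map_mat of_int (adjacency_mat V E :: int mat)"
    by (rule eq_matI) (auto simp: adjacency_mat_def)
  then show ?thesis by (simp add: of_int_hom.char_poly_hom[OF adjacency_mat_carrier])
qed

section \<open>Rayleigh quotients\<close>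

text \<open>The unit sphere over \<open>V\<close> is modelled by functions vanishing outside
  \<open>V\<close>: a closed subset of the cube of functions into \<open>[-1, 1]\<close>, which is
  compact by Tychonoff's theorem.\<close>

lemma compact_sphere_functions:
  assumes "finite V"
  shows "compact {g :: 'v \<Rightarrow> real. (\<forall>v. v \<notin> V \<longrightarrow> g v = 0) \<and> (\<Sum>v\<in>V. (g v)\<^sup>2) = 1}" (is "compact ?S")
proof -
  have "compactin (product_topology (\<lambda>i. euclidean) UNIV) (Pi\<^sub>E UNIV (\<lambda>_::'v. {-1..1::real}))"
    by (subst compactin_PiE) auto
  then have K: "compact (Pi\<^sub>E UNIV (\<lambda>_::'v. {-1..1::real}))"
    by (simp add: euclidean_product_topology)
  have "?S = (\<Inter>v\<in>-V. {g. g v = 0}) \<inter> {g. (\<Sum>v\<in>V. (g v)\<^sup>2) = 1}" by auto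
  moreover have "closed \<dots>"
    by (intro closed_Int closed_INT ballI closed_Collect_eq continuous_intros
        continuous_on_product_coordinates)
  ultimately have cl: "closed ?S" by simp
  have "?S \<subseteq> Pi\<^sub>E UNIV (\<lambda>_. {-1..1})"
  proof
    fix g assume g: "g \<in> ?S"
    have "\<bar>g v\<bar> \<le> 1" for v
    proof (cases "v \<in> V")
      case True
      then have "(g v)\<^sup>2 \<le> (\<Sum>v\<in>V. (g v)\<^sup>2)" using assms by (intro member_le_sum) auto
      then show ?thesis using g by (simp add: abs_square_le_1)
    qed (use g in auto)
    then show "g \<in> Pi\<^sub>E UNIV (\<lambda>_. {-1..1})" by (auto simp: abs_le_iff minus_le_iff)
  qed
  then show ?thesis using compact_Int_closed[OF K cl] by (simp add: Int_absorb1)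
qed

text \<open>
  At a maximiser \<open>g\<close> the positive semidefinite form \<open>M |u|\<^sup>2 - Q u\<close> vanishes, hence so does its
  polar form against any vector.
\<close>

lemma rayleigh_maximum_eigenvalue:
  fixes a :: "'v \<Rightarrow> 'v \<Rightarrow> real"
  assumes V: "finite V" "V \<noteq> {}" and sym: "\<And>v w. a v w = a w v"
  obtains g M where "\<exists>v\<in>V. g v \<noteq> 0" "\<forall>v\<in>V. (\<Sum>w\<in>V. a v w * g w) = M * g v"
    "\<forall>u. (\<Sum>v\<in>V. \<Sum>w\<in>V. u v * a v w * u w) \<le> M * (\<Sum>v\<in>V. (u v)\<^sup>2)"
proof -
  define B where "B u h = (\<Sum>v\<in>V. \<Sum>w\<in>V. u v * a v w * h w)" for u h
  define N where "N u h = (\<Sum>v\<in>V. u v * h v)" for u h :: "'v \<Rightarrow> real"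
  let ?S = "{g :: 'v \<Rightarrow> real. (\<forall>v. v \<notin> V \<longrightarrow> g v = 0) \<and> (\<Sum>v\<in>V. (g v)\<^sup>2) = 1}"
  obtain v0 where v0: "v0 \<in> V" using V by auto
  have "(\<Sum>v\<in>V. (if v = v0 then 1 else 0 :: real)\<^sup>2) = (\<Sum>v\<in>V. if v = v0 then 1 else 0)"
    by (intro sum.cong) auto
  then have "(\<lambda>v. if v = v0 then 1 else 0) \<in> ?S" using v0 V by auto
  then have "?S \<noteq> {}" by (intro notI) (simp only: empty_iff)
  moreover have "continuous_on ?S (\<lambda>g. B g g)"
    unfolding B_def
    by (intro continuous_intros continuous_on_subset[OF continuous_on_product_coordinates subset_UNIV])
  ultimately obtain g where g: "g \<in> ?S" and max: "\<And>u. u \<in> ?S \<Longrightarrow> B u u \<le> B g g"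
    using continuous_attains_sup[OF compact_sphere_functions[OF V(1)], of "\<lambda>g. B g g"] by blast
  define M where "M = B g g"
  \<comment> \<open>By homogeneity the maximum over the sphere bounds the form everywhere;
    \<open>?ru\<close> is \<open>u\<close> restricted to \<open>V\<close> and normalised.\<close>
  have ray: "B u u \<le> M * N u u" for u
  proof (cases "N u u = 0")
    case True
    then have "\<forall>v\<in>V. u v = 0"
      using V unfolding N_def by (subst (asm) sum_nonneg_eq_0_iff) auto
    then show ?thesis using True by (simp add: B_def)
  next
    case False
    have "N u u \<ge> 0" unfolding N_def by (intro sum_nonneg) auto
    with False have pos: "N u u > 0" by simp
    define r where "r = 1 / sqrt (N u u)"
    have r2: "r * r = 1 / N u u" using pos by (simp add: r_def)
    let ?ru = "\<lambda>v. if v \<in> V then r * u v else 0"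
    have "?ru \<in> ?S"
    proof -
      have "(\<Sum>v\<in>V. (?ru v)\<^sup>2) = r * r * N u u"
        unfolding N_def sum_distrib_left by (intro sum.cong) (auto simp: power2_eq_square)
      then show ?thesis using r2 pos by simp
    qed
    from max[OF this] have "B ?ru ?ru \<le> M"
      by (simp add: M_def)
    also have "B ?ru ?ru = r * r * B u u"
      unfolding B_def sum_distrib_left by (intro sum.cong) auto
    finally show ?thesis using pos by (simp add: r2 field_simps)
  qed
  have Ng: "N g g = 1" using g by (simp add: N_def power2_eq_square)
  have orth: "B g u = M * N g u" for u
  proof -
    define b where "b = M * N g u - B g u"
    define c where "c = M * N u u - B u u"
    have "c \<ge> 0" using ray by (simp add: c_def)
    \<comment> \<open>The semidefinite form at \<open>g + t * u\<close>, whose constant term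
      vanishes; a nonzero linear coefficient would make it negative for some
      \<open>t\<close>.\<close>
    have q: "2 * t * b + t * t * c \<ge> 0" for t
    proof -
      let ?h = "\<lambda>v. g v + t * u v"
      have Bs: "B u g = B g u" unfolding B_def
        by (subst sum.swap) (simp add: sym mult_ac)
      have "B ?h ?h = B g g + t * B g u + t * B u g + t * t * B u u"
        unfolding B_def sum_distrib_left sum.distrib[symmetric]
        by (intro sum.cong refl) (simp add: algebra_simps)
      moreover have "N ?h ?h = N g g + 2 * t * N g u + t * t * N u u"
        unfolding N_def sum_distrib_left sum.distrib[symmetric]
        by (intro sum.cong refl) (simp add: algebra_simps)
      ultimately show ?thesis
        using ray[of ?h] by (simp add: Bs Ng b_def c_def M_def[symmetric] algebra_simps)
    qed
    have "b = 0"
    proof (rule ccontr)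
      assume "b \<noteq> 0"
      \<comment> \<open>For positive \<open>c\<close> the quadratic is minimal at
        \<open>- b / c\<close>; adding 1 keeps the denominator positive when
        \<open>c = 0\<close>.\<close>
      define t where "t = - b / (c + 1)"
      have "2 * t * b + t * t * c = - (b * b) * (c + 2) / ((c + 1) * (c + 1))"
        using \<open>c \<ge> 0\<close> by (simp add: t_def divide_simps) (simp add: algebra_simps)
      moreover have "0 < b * b" using \<open>b \<noteq> 0\<close> by (metis not_real_square_gt_zero)
      ultimately have "2 * t * b + t * t * c < 0"
        using \<open>c \<ge> 0\<close> by (simp only:) (intro divide_neg_pos mult_neg_pos; simp)
      then show False using q[of t] by simp
    qed
    then show ?thesis by (simp add: b_def)
  qed
  show ?thesis
  proof (rule that[of g M])
    show "\<exists>v\<in>V. g v \<noteq> 0" using Ng by (intro ccontr[of "\<exists>v\<in>V. g v \<noteq> 0"]) (simp add: N_def)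
    show "\<forall>u. (\<Sum>v\<in>V. \<Sum>w\<in>V. u v * a v w * u w) \<le> M * (\<Sum>v\<in>V. (u v)\<^sup>2)"
      using ray by (simp add: B_def N_def power2_eq_square)
    show "\<forall>v\<in>V. (\<Sum>w\<in>V. a v w * g w) = M * g v"
    proof
      fix v assume v: "v \<in> V"
      let ?e = "\<lambda>w. if w = v then 1 else 0 :: real"
      have "B g ?e = (\<Sum>w\<in>V. g w * a w v)"
        unfolding B_def using V v by (simp add: if_distrib cong: if_cong)
      moreover have "N g ?e = g v"
        unfolding N_def using V v by (simp add: if_distrib cong: if_cong)
      ultimately show "(\<Sum>w\<in>V. a v w * g w) = M * g v" using orth[of ?e] by (simp add: sym[of v] mult.commute)
    qed
  qed
qed

text \<open>The Hermitian form \<open>T\<close> at \<open>f\<close> equals its own conjugate, so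
  \<open>T = \<mu> * S\<close> makes \<open>\<mu>\<close> real. As the matrix entries are
  nonnegative, \<open>cmod T\<close> is at most the form at the moduli of \<open>f\<close>, to which
  the bound \<open>M\<close> applies.\<close>

lemma complex_adjacency_eigenvalue:
  assumes V: "finite V" and E: "sym E" and f: "adjacency_eigenvector V E \<mu> f"
  shows "\<mu> \<in> \<real>"
    and "(\<And>u. (\<Sum>v\<in>V. \<Sum>w\<in>V. u v * of_bool ((v, w) \<in> E) * u w)
      \<le> M * (\<Sum>v\<in>V. (u v)\<^sup>2)) \<Longrightarrow> cmod \<mu> \<le> M"
proof -
  define S where "S = (\<Sum>v\<in>V. (cmod (f v))\<^sup>2)"
  define T where "T = (\<Sum>v\<in>V. \<Sum>w\<in>V. cnj (f v) * of_bool ((v, w) \<in> E) * f w)"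
  have "S > 0"
    unfolding S_def using f V by (auto simp: adjacency_eigenvector_def intro!: sum_pos2)
  have "T = (\<Sum>v\<in>V. cnj (f v) * (\<Sum>w\<in>V. of_bool ((v, w) \<in> E) * f w))"
    by (simp add: T_def sum_distrib_left mult_ac)
  also have "\<dots> = (\<Sum>v\<in>V. cnj (f v) * (\<mu> * f v))"
    using f by (intro sum.cong) (auto simp: adjacency_eigenvector_def)
  also have "\<dots> = \<mu> * of_real S"
    unfolding S_def of_real_sum sum_distrib_left complex_norm_square
    by (intro sum.cong) (auto simp: mult_ac)
  finally have T: "T = \<mu> * of_real S" .
  have "cnj T = (\<Sum>v\<in>V. \<Sum>w\<in>V. f v * of_bool ((v, w) \<in> E) * cnj (f w))"
    unfolding T_def cnj_sum by (intro sum.cong) (auto simp: of_bool_def)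
  also have "\<dots> = T"
    unfolding T_def using E
    by (subst sum.swap) (auto simp: sym_def mult_ac intro!: sum.cong arg_cong2[of _ _ _ _ times])
  finally have "cnj \<mu> = \<mu>" using T \<open>S > 0\<close> by simp
  then show "\<mu> \<in> \<real>" by (simp add: Reals_cnj_iff)
  assume M: "\<And>u. (\<Sum>v\<in>V. \<Sum>w\<in>V. u v * of_bool ((v, w) \<in> E) * u w) \<le> M * (\<Sum>v\<in>V. (u v)\<^sup>2)"
  have "cmod \<mu> * S = cmod T" using T \<open>S > 0\<close> by (simp add: norm_mult)
  also have "\<dots> \<le> (\<Sum>v\<in>V. \<Sum>w\<in>V. cmod (f v) * of_bool ((v, w) \<in> E) * cmod (f w))"
    unfolding T_def by (intro order.trans[OF norm_sum] sum_mono) (auto simp: norm_mult)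
  also have "\<dots> \<le> M * S" using M[of "\<lambda>v. cmod (f v)"] by (simp add: S_def)
  finally show "cmod \<mu> \<le> M" using \<open>S > 0\<close> by simp
qed

section \<open>Graphs with prescribed spectral radius\<close>

lemma spectrum_adjacency_matrix:
  assumes "finite (pverts G)"
  shows "spectrum (adjacency_matrix G) = {c. \<exists>f. adjacency_eigenvector (pverts G) (parcs G) c f}"
  by (auto simp: spectrum_def adjacency_matrix_eq eigenvalue_adjacency_mat_iff[OF assms])

lemma finite_spectrum_adjacency_matrix: "finite (spectrum (adjacency_matrix G))"
  unfolding adjacency_matrix_eq by (rule card_finite_spectrum(1)[OF adjacency_mat_carrier])

lemma graph_spectral_radius_conjugates:
  assumes "pair_graph G" and ne: "pverts G \<noteq> {}"
  defines "x \<equiv> graph_spectral_radius G"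
  shows "totally_real_algebraic_int x \<and> (\<forall>y\<in>algebraic_conjugates x. cmod y \<le> x)"
proof -
  interpret pair_graph G by fact
  let ?V = "pverts G" and ?E = "parcs G"
  have symE: "sym ?E" using pair_sym_arcs by (simp add: symmetric_def)
  then have of_bool_sym: "of_bool ((v, w) \<in> ?E) = (of_bool ((w, v) \<in> ?E) :: real)" for v w
    by (auto simp: sym_def)
  obtain g and M :: real where g: "\<exists>v\<in>?V. g v \<noteq> 0"
      "\<forall>v\<in>?V. (\<Sum>w\<in>?V. of_bool ((v, w) \<in> ?E) * g w) = M * g v"
    and ray: "\<forall>u. (\<Sum>v\<in>?V. \<Sum>w\<in>?V. u v * of_bool ((v, w) \<in> ?E) * u w) \<le> M * (\<Sum>v\<in>?V. (u v)\<^sup>2)"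
    by (rule rayleigh_maximum_eigenvalue[where a = "\<lambda>v w. of_bool ((v, w) \<in> ?E)",
          OF pair_finite_verts ne of_bool_sym])
  \<comment> \<open>The Rayleigh bound \<open>M\<close> is itself an eigenvalue: it is at most
    \<open>x\<close>, and it makes the spectrum nonempty, so that \<open>Max\<close> is
    attained.\<close>
  have Msp: "M \<in> spectrum (adjacency_matrix G)"
    using g unfolding spectrum_adjacency_matrix[OF pair_finite_verts] adjacency_eigenvector_def by blast
  have Mx: "M \<le> x"
    unfolding x_def graph_spectral_radius_def using Msp finite_spectrum_adjacency_matrix
    by (rule Max_ge[rotated])
  have xsp: "x \<in> spectrum (adjacency_matrix G)"
    unfolding x_def graph_spectral_radius_def using Msp finite_spectrum_adjacency_matrix
    by (intro Max_in) auto
  define P where "P = char_poly (adjacency_mat ?V ?E :: int mat)"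
  have P1: "lead_coeff P = 1"
    unfolding P_def by (metis degree_monic_char_poly[OF adjacency_mat_carrier])
  have "eigenvalue (adjacency_mat ?V ?E) x"
    using xsp by (simp add: spectrum_def adjacency_matrix_eq)
  then have Px: "ipoly P x = 0"
    unfolding P_def char_poly_adjacency_mat[symmetric]
      eigenvalue_root_char_poly[OF adjacency_mat_carrier] .
  have alg: "algebraic_int x" using P1 Px by (auto simp: algebraic_int_altdef_ipoly)
  then obtain f where f: "int_min_poly f x" using int_min_poly_exists by blast
  have "y \<in> \<real> \<and> cmod y \<le> x" if y: "y \<in> algebraic_conjugates x" for y
  proof -
    have "ipoly f y = 0" using y by (simp add: algebraic_conjugates_int_min_poly[OF f])
    moreover have "f dvd P" using f Px by (auto simp: int_min_poly_def)
    ultimately have "ipoly P y = 0" by (auto simp: dvd_def)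
    then have "eigenvalue (adjacency_mat ?V ?E) y"
      unfolding P_def char_poly_adjacency_mat[symmetric]
        eigenvalue_root_char_poly[OF adjacency_mat_carrier] .
    then obtain h where h: "adjacency_eigenvector ?V ?E y h"
      using eigenvalue_adjacency_mat_iff[OF pair_finite_verts] by blast
    have "y \<in> \<real>" by (rule complex_adjacency_eigenvalue(1)[OF pair_finite_verts symE h])
    moreover have "cmod y \<le> M"
      by (rule complex_adjacency_eigenvalue(2)[OF pair_finite_verts symE h ray[rule_format]])
    ultimately show ?thesis using Mx by simp
  qed
  then show ?thesis using alg by (auto simp: totally_real_algebraic_int_def)
qed

section \<open>Positive eigenvectors and the spectral radius\<close>

text \<open>At a vertex \<open>v\<close> where \<open>\<bar>f v\<bar> / h v\<close> is largest, the
  eigenvalue equation of \<open>f\<close> is dominated by that of \<open>h\<close>.\<close>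

lemma adjacency_eigenvalue_le_perron:
  fixes h f :: "'v \<Rightarrow> real"
  assumes V: "finite V" and h: "\<And>v. v \<in> V \<Longrightarrow> 0 < h v"
    and ev: "adjacency_eigenvector V E x h" and f: "adjacency_eigenvector V E \<mu> f"
  shows "\<mu> \<le> x"
proof -
  let ?q = "\<lambda>v. \<bar>f v\<bar> / h v"
  obtain v1 where v1: "v1 \<in> V" "f v1 \<noteq> 0" using f by (auto simp: adjacency_eigenvector_def)
  have "Max (?q ` V) \<in> ?q ` V" using V v1 by (intro Max_in) auto
  then obtain v where v: "v \<in> V" "Max (?q ` V) = ?q v" by auto
  have max: "?q w \<le> ?q v" if "w \<in> V" for w
    using V that unfolding v(2)[symmetric] by (intro Max_ge) auto
  have le: "\<bar>f w\<bar> \<le> ?q v * h w" if "w \<in> V" for w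
    using max[OF that] h[OF that] by (simp add: divide_le_eq)
  have "0 < ?q v1" using v1 h by simp
  then have "0 < ?q v" using max[OF v1(1)] by linarith
  then have fv: "0 < \<bar>f v\<bar>" using h[OF v(1)] by (simp add: zero_less_divide_iff)
  have "\<bar>\<mu>\<bar> * \<bar>f v\<bar> = \<bar>\<Sum>w\<in>V. of_bool ((v, w) \<in> E) * f w\<bar>"
    using f v by (simp add: adjacency_eigenvector_def abs_mult)
  also have "\<dots> \<le> (\<Sum>w\<in>V. of_bool ((v, w) \<in> E) * \<bar>f w\<bar>)"
    by (rule order.trans[OF sum_abs]) (simp add: abs_mult)
  also have "\<dots> \<le> (\<Sum>w\<in>V. of_bool ((v, w) \<in> E) * (?q v * h w))"
    using le by (intro sum_mono mult_left_mono) auto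
  also have "\<dots> = ?q v * (\<Sum>w\<in>V. of_bool ((v, w) \<in> E) * h w)"
    by (simp add: sum_distrib_left mult_ac)
  also have "\<dots> = ?q v * (x * h v)" using ev v by (simp add: adjacency_eigenvector_def)
  also have "\<dots> = x * \<bar>f v\<bar>" using h[OF v(1)] by simp
  finally have "\<bar>\<mu>\<bar> \<le> x" using fv by simp
  then show ?thesis by simp
qed

text \<open>A positive eigenvector certifies the spectral radius, so a construction only has to
  verify one local sum per vertex. An injection into \<open>nat\<close> transports the graph from
  any vertex type.\<close>

lemma spectral_radius_order_finiteI:
  fixes h :: "'v \<Rightarrow> real"
  assumes V: "finite V" "V \<noteq> {}" and E: "E \<subseteq> V \<times> V" "sym E" "irrefl E"
    and pos: "\<And>v. v \<in> V \<Longrightarrow> 0 < h v"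
    and ev: "\<And>v. v \<in> V \<Longrightarrow> (\<Sum>w\<in>E `` {v}. h w) = x * h v"
  shows "spectral_radius_order x < \<infinity>"
proof -
  obtain e :: "'v \<Rightarrow> nat" where e: "inj_on e V"
    using ex_bij_betw_finite_nat[OF V(1)] bij_betw_imp_inj_on by blast
  define G where "G = \<lparr>pverts = e ` V, parcs = map_prod e e ` E\<rparr>"
  have mem: "(e v, e w) \<in> parcs G \<longleftrightarrow> (v, w) \<in> E" if "v \<in> V" "w \<in> V" for v w
  proof
    assume "(e v, e w) \<in> parcs G"
    then obtain v' w' where *: "(v', w') \<in> E" "e v = e v'" "e w = e w'" by (auto simp: G_def)
    then have "v = v'" "w = w'" using that E(1) by (auto intro: inj_onD[OF e])
    then show "(v, w) \<in> E" using * by simp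
  qed (auto simp: G_def)
  have "finite E" using E(1) V finite_subset by blast
  have graph: "pair_graph G"
  proof
    show "fst a \<in> pverts G" "snd a \<in> pverts G" if "a \<in> parcs G" for a
      using that E(1) by (auto simp: G_def)
    show "finite (pverts G)" "finite (parcs G)" using V \<open>finite E\<close> by (auto simp: G_def)
    show "fst a \<noteq> snd a" if a: "a \<in> parcs G" for a
    proof -
      obtain v w where *: "a = (e v, e w)" "(v, w) \<in> E" using a by (auto simp: G_def)
      then have "v \<in> V" "w \<in> V" "v \<noteq> w" using E(1,3) by (auto simp: irrefl_def)
      then show ?thesis using * inj_onD[OF e] by auto
    qed
    show "symmetric G" using E(2) by (auto simp: G_def symmetric_def sym_def)
  qed
  define h' where "h' = h \<circ> inv_into V e"
  have h': "h' (e v) = h v" if "v \<in> V" for v using that e by (simp add: h'_def)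
  have "(\<Sum>w\<in>pverts G. of_bool ((e v, w) \<in> parcs G) * h' w) = x * h' (e v)" if v: "v \<in> V" for v
  proof -
    have "(\<Sum>w\<in>pverts G. of_bool ((e v, w) \<in> parcs G) * h' w)
        = (\<Sum>w\<in>V. of_bool ((e v, e w) \<in> parcs G) * h' (e w))"
      using e by (simp add: G_def sum.reindex)
    also have "\<dots> = (\<Sum>w\<in>V. if (v, w) \<in> E then h w else 0)"
      using v by (intro sum.cong) (auto simp: mem h')
    also have "\<dots> = (\<Sum>w\<in>E `` {v}. h w)"
      using V E(1) by (intro sum.mono_neutral_cong_right) auto
    finally show ?thesis using ev v h' by simp
  qed
  moreover have pos': "0 < h' w" if "w \<in> pverts G" for w
    using that h' pos by (auto simp: G_def)
  ultimately have eig: "adjacency_eigenvector (pverts G) (parcs G) x h'"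
    using V by (fastforce simp: adjacency_eigenvector_def G_def)
  have fin: "finite (pverts G)" using V by (simp add: G_def)
  have "graph_spectral_radius G = x"
    unfolding graph_spectral_radius_def
  proof (rule Max_eqI[OF finite_spectrum_adjacency_matrix])
    show "x \<in> spectrum (adjacency_matrix G)"
      using eig by (auto simp: spectrum_adjacency_matrix[OF fin])
    show "\<mu> \<le> x" if "\<mu> \<in> spectrum (adjacency_matrix G)" for \<mu>
      using that adjacency_eigenvalue_le_perron[OF fin pos' eig]
      by (auto simp: spectrum_adjacency_matrix[OF fin])
  qed
  moreover have "pverts G \<noteq> {}" using V by (simp add: G_def)
  ultimately have "spectral_radius_order x \<le> enat (card (pverts G))"
    unfolding spectral_radius_order_def using graph by (intro Inf_lower) blast
  then show ?thesis using enat_ord_simps(4) le_less_trans by blast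
qed

section \<open>Explicit graphs\<close>

lemma spectral_radius_order_2: "spectral_radius_order 2 < \<infinity>"
proof -
  let ?V = "{0::nat, 1, 2}"
  let ?E = "{(i, j). i \<in> ?V \<and> j \<in> ?V \<and> i \<noteq> j}"
  show ?thesis
  proof (rule spectral_radius_order_finiteI[of ?V ?E "\<lambda>_. 1"])
    fix v :: nat assume v: "v \<in> ?V"
    then have "?E `` {v} = ?V - {v}" by auto
    then show "(\<Sum>w\<in>?E `` {v}. 1) = 2 * (1::real)"
      using v by (simp add: card_Diff_singleton)
  qed (auto simp: sym_def irrefl_def)
qed

text \<open>With \<open>t = pi / m\<close>,
  \<open>sin ((i - 1) t) + sin ((i + 1) t) = 2 cos t * sin (i t)\<close>; the sines vanish at
  \<open>i = 0\<close> and \<open>i = m\<close>, so the missing neighbours of the end vertices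
  contribute nothing.\<close>

lemma spectral_radius_order_path:
  assumes m: "3 \<le> m"
  shows "spectral_radius_order (2 * cos (pi / real m)) < \<infinity>"
proof -
  let ?V = "{1..<m}"
  let ?E = "{(i, j). i \<in> ?V \<and> j \<in> ?V \<and> (j = i + 1 \<or> i = j + 1)}"
  let ?h = "\<lambda>i. sin (real i * (pi / real m))"
  show ?thesis
  proof (rule spectral_radius_order_finiteI[of ?V ?E ?h])
    fix i assume i: "i \<in> ?V"
    show "0 < ?h i" using i m by (intro sin_gt_zero) (auto simp: field_simps)
    have "(\<Sum>w\<in>?E `` {i}. ?h w) = (\<Sum>w\<in>{i - 1, i + 1}. ?h w)"
    proof (rule sum.mono_neutral_left)
      show "\<forall>w\<in>{i - 1, i + 1} - ?E `` {i}. ?h w = 0"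
      proof
        fix w assume "w \<in> {i - 1, i + 1} - ?E `` {i}"
        then have "w = 0 \<or> w = m" using i by auto
        then show "?h w = 0" using m by auto
      qed
    qed (use i in auto)
    also have "\<dots> = ?h (i - 1) + ?h (i + 1)" by simp
    also have "\<dots> = 2 * cos (pi / real m) * ?h i"
    proof -
      have "sin (real (i - 1) * t) + sin (real (i + 1) * t) = 2 * cos t * sin (real i * t)" for t
        using i by (simp add: of_nat_diff left_diff_distrib distrib_right sin_add sin_diff)
      then show ?thesis .
    qed
    finally show "(\<Sum>w\<in>?E `` {i}. ?h w) = 2 * cos (pi / real m) * ?h i" .
  qed (use m in \<open>auto simp: sym_def irrefl_def\<close>)
qed

text \<open>The vertices with \<open>s = 0\<close> form complete graphs on \<open>k + 1\<close>
  vertices, one for each \<open>q\<close>; those with \<open>s > 0\<close> form complete graphs on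
  \<open>l + 1\<close> vertices, one for each \<open>p\<close> and \<open>s\<close>. Each
  \<open>(p, q, 0)\<close> is joined to its \<open>c\<close> copies \<open>(p, q, t)\<close>. The
  quotient matrix has rows \<open>k, c\<close> and \<open>1, l\<close>, with eigenvector
  \<open>(x - l, 1)\<close>.\<close>

lemma spectral_radius_order_biregular:
  fixes k l c :: nat and x :: real
  assumes x: "(x - k) * (x - l) = c" "l < x"
  shows "spectral_radius_order x < \<infinity>"
proof -
  let ?V = "{..k} \<times> {..l} \<times> {..c}"
  define E where "E = {((p, q, s), (p', q', t)). (p, q, s) \<in> ?V \<and> (p', q', t) \<in> ?V \<and>
    (s = 0 \<and> t = 0 \<and> q = q' \<and> p \<noteq> p' \<or> 0 < s \<and> t = s \<and> p = p' \<and> q \<noteq> q' \<or>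
     p = p' \<and> q = q' \<and> (s = 0) \<noteq> (t = 0))}"
  define h where "h = (\<lambda>(p::nat, q::nat, s::nat). if s = 0 then x - l else 1)"
  show ?thesis
  proof (rule spectral_radius_order_finiteI[of ?V E h])
    fix v assume v: "v \<in> ?V"
    obtain p q s where pqs: "v = (p, q, s)" by (cases v)
    show "0 < h v" using x(2) by (simp add: pqs h_def)
    show "(\<Sum>w\<in>E `` {v}. h w) = x * h v"
    proof (cases "s = 0")
      case True
      have "E `` {v} = (\<lambda>p'. (p', q, 0)) ` ({..k} - {p}) \<union> (\<lambda>t. (p, q, t)) ` {1..c}"
        using v True by (auto simp: E_def pqs)
      also have "(\<Sum>w\<in>\<dots>. h w)
          = (\<Sum>w\<in>(\<lambda>p'. (p', q, 0)) ` ({..k} - {p}). h w) + (\<Sum>w\<in>(\<lambda>t. (p, q, t)) ` {1..c}. h w)"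
        by (intro sum.union_disjoint) auto
      also have "\<dots> = k * (x - l) + c"
        using v by (simp add: sum.reindex inj_on_def h_def pqs)
      also have "\<dots> = x * h v" using True x(1) by (simp add: h_def pqs algebra_simps)
      finally show ?thesis .
    next
      case False
      have "E `` {v} = insert (p, q, 0) ((\<lambda>q'. (p, q', s)) ` ({..l} - {q}))"
        using v False by (auto simp: E_def pqs)
      also have "(\<Sum>w\<in>\<dots>. h w) = h (p, q, 0) + (\<Sum>w\<in>(\<lambda>q'. (p, q', s)) ` ({..l} - {q}). h w)"
        using False by (intro sum.insert) auto
      also have "\<dots> = x - l + l"
        using v False by (simp add: sum.reindex inj_on_def h_def pqs)
      also have "\<dots> = x * h v" using False by (simp add: h_def pqs)
      finally show ?thesis .
    qed
  qed (auto simp: E_def sym_def irrefl_def)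
qed

lemma spectral_radius_order_quadratic:
  fixes x :: real
  assumes f: "int_min_poly f x" "degree f = 2"
    and bd: "\<And>y::complex. ipoly f y = 0 \<Longrightarrow> cmod y \<le> x"
  shows "spectral_radius_order x < \<infinity>"
proof -
  define a where "a = - coeff f 1"
  define b where "b = - coeff f 0"
  have "coeff f 2 = 1" using f by (simp add: int_min_poly_def)
  then have fe: "f = [:- b, - a, 1:]"
    using f(2)
    by (intro poly_eqI) (auto simp: a_def b_def coeff_pCons coeff_eq_0 numeral_2_eq_2 split: nat.split)
  have fx: "ipoly f x = 0" using f by (simp add: int_min_poly_def)
  have "ipoly f y = y * y - a * y - b" for y :: real
    by (simp add: fe hom_distribs algebra_simps)
  \<comment> \<open>The other root of \<open>f\<close> is \<open>a - x\<close>; bounding its modulus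
    by \<open>x\<close> gives \<open>0 \<le> a \<le> 2 * x\<close>, so both halves of
    \<open>a\<close> are nonnegative.\<close>
  from this[of x] this[of "a - x"] fx have x: "x * x = a * x + b" and "ipoly f (a - x) = 0"
    by (auto simp: algebra_simps)
  then have "cmod (of_real (a - x)) \<le> x" by (intro bd) (simp only: ipoly_of_real of_real_0)
  then have ax: "\<bar>a - x\<bar> \<le> x" by (simp only: norm_of_real real_norm_def)
  then have a: "0 \<le> a" "a \<le> 2 * x" by auto
  have nint: "x \<noteq> of_int i" for i
  proof
    assume "x = of_int i"
    then have "ipoly [:- i, 1:] x = 0" by (simp add: hom_distribs)
    then have "f dvd [:- i, 1:]" using f by (auto simp: int_min_poly_def)
    then have "degree f \<le> 1" using dvd_imp_degree_le[of f "[:- i, 1:]"] by simp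
    then show False using f by simp
  qed
  \<comment> \<open>Splitting the trace as evenly as possible makes \<open>4 * c\<close> at least
    -1, hence the integer \<open>c\<close> nonnegative; it is nonzero as \<open>x\<close> is no
    integer.\<close>
  define k where "k = a div 2"
  define l where "l = a - k"
  define c where "c = b + k * l"
  have kl: "0 \<le> k" "0 \<le> l" "l - k \<in> {0, 1}" "a = k + l" using a by (auto simp: k_def l_def)
  have c: "(x - k) * (x - l) = c" using x kl(4) by (simp add: c_def algebra_simps)
  have "4 * ((x - k) * (x - l)) = (2 * x - a)\<^sup>2 - (real_of_int (l - k))\<^sup>2"
    by (simp add: kl(4) power2_eq_square algebra_simps)
  moreover have "(real_of_int (l - k))\<^sup>2 \<le> 1" using kl(3) by (auto simp del: of_int_diff)
  moreover have "0 \<le> (2 * x - a)\<^sup>2" by simp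
  ultimately have "4 * real_of_int c \<ge> -1" using c by linarith
  then have "c \<ge> 0" by linarith
  moreover have "c \<noteq> 0" using c nint[of k] nint[of l] by auto
  ultimately have "c > 0" by simp
  have "x \<ge> k" using a kl by auto
  then have "x > k" using nint[of k] by simp
  then have "x > l" using c \<open>c > 0\<close> by (metis diff_gt_0_iff_gt of_int_0_less_iff zero_less_mult_pos)
  then show ?thesis
    using spectral_radius_order_biregular[of x "nat k" "nat l" "nat c"] c kl \<open>c > 0\<close> by simp
qed

theorem theorem1p4:
  fixes x :: real
  assumes "0 < x"
    and "(algebraic x \<and> algebraic_degree x = 2) \<or> x \<le> 2"
  shows "spectral_radius_order x < \<infinity> \<longleftrightarrow>
    totally_real_algebraic_int x \<and> (\<forall>y \<in> algebraic_conjugates x. cmod y \<le> x)"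
proof
  assume "spectral_radius_order x < \<infinity>"
  \<comment> \<open>The infimum of the empty set is infinite, so a finite order provides a
    graph.\<close>
  then have "{enat (card (pverts G)) | G :: nat pair_pre_digraph.
      pair_graph G \<and> pverts G \<noteq> {} \<and> graph_spectral_radius G = x} \<noteq> {}"
    unfolding spectral_radius_order_def by (metis Inf_empty less_irrefl top_enat_def)
  then show "totally_real_algebraic_int x \<and> (\<forall>y\<in>algebraic_conjugates x. cmod y \<le> x)"
    using graph_spectral_radius_conjugates by blast
next
  assume R: "totally_real_algebraic_int x \<and> (\<forall>y\<in>algebraic_conjugates x. cmod y \<le> x)"
  then obtain f where f: "int_min_poly f x"
    using int_min_poly_exists unfolding totally_real_algebraic_int_def by blast
  have bd: "y \<in> \<real> \<and> cmod y \<le> x" if "ipoly f y = 0" for y :: complex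
    using R that by (auto simp: totally_real_algebraic_int_def algebraic_conjugates_int_min_poly[OF f])
  from assms(2) show "spectral_radius_order x < \<infinity>"
  proof
    assume "algebraic x \<and> algebraic_degree x = 2"
    then have "degree f = 2" by (simp add: algebraic_degree_def int_min_poly_min_poly[OF f])
    then show ?thesis using spectral_radius_order_quadratic[OF f] bd by blast
  next
    assume "x \<le> 2"
    then show ?thesis
      using max_conjugate_le_2_cases[OF f assms(1)] bd spectral_radius_order_2 spectral_radius_order_path
      by blast
  qed
qed

end
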